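(* Let $A(\mu)\in\mathbb{R}^{n\times n}$ be nonsingular and analytic in $\mu\in\mathbb{R}$, with Taylor coefficients $A_\ell=A^{(\ell)}(0)/\ell!$ at the origin. Let $m\ge 1$, let $A_m(\mu)=\sum_{\ell=0}^m A_\ell\mu^\ell$ (assumed nonsingular), and let $b\in\mathbb{R}^n$. Let $K_m,M_m\in\mathbb{R}^{(m+1)n\times(m+1)n}$ and $c_m\in\mathbb{R}^{(m+1)n}$ be the companion matrices and right-hand side defined in the context. Then the solutions of $$A_m(\mu)\,x_m(\mu)=b \qquad (\mathrm{I})$$ and of $$(K_m-\mu M_m)\,v_m(\mu)=c_m \qquad (\mathrm{II})$$ are equivalent in the following sense. (a) If a solution of (II) is of the form $$v_m(\mu)=\begin{bmatrix}\mu^0x_m(\mu)^T,\ \mu\, x_m(\mu)^T,\ \ldots,\ \mu^m x_m(\mu)^T\end{bmatrix}^T\in\mathbb{R}^{(m+1)n}\qquad(\mathrm{III})$$ with $x_m(\mu)\in\mathbb{R}^n$, then $x_m(\mu)$ satisfies (I). (b) If $x_m(\mu)$ satisfies (I), then $v_m(\mu)$ defined by (III) satisfies (II).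
   Context: All matrices below are partitioned into $(m+1)\times(m+1)$ blocks of size $n\times n$; $I$ is the $n\times n$ identity and unspecified blocks are zero. $$K_m=\begin{bmatrix} A_0 & A_1 & A_2 & \cdots & A_m \\ & I & & & \\ & & I & & \\ & & & \ddots & \\ & & & & I \end{bmatrix},\qquad M_m=\begin{bmatrix} 0 & 0 & \cdots & \cdots & 0 \\ I & & & & \\ & I & & & \\ & & \ddots & & \\ & & & I & 0 \end{bmatrix},\qquad c_m=\begin{bmatrix} b \\ 0 \\ \vdots \\ 0 \end{bmatrix}.$$ That is, $K_m$ has first block row $[A_0,A_1,\ldots,A_m]$ and identity blocks in the diagonal positions $2,\ldots,m+1$; $M_m$ has identity blocks on the first block subdiagonal and zeros elsewhere. The convention $\mu^0=1$ is used. *)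

theory Defs
  imports "HOL-Analysis.FPS_Convergence" "Jordan_Normal_Form.Matrix"
begin

unbundle no fps_syntax
unbundle no vec_syntax

definition real_analytic_on :: "(real \<Rightarrow> real) \<Rightarrow> real set \<Rightarrow> bool" where
  "real_analytic_on f S \<longleftrightarrow> (\<forall>x\<in>S. \<exists>F. (\<lambda>h. f (x + h)) has_fps_expansion F)"

text \<open>The type of matrices of variable size carries no topology, so analyticity and
  derivatives of a matrix-valued function are taken entrywise.\<close>

definition analytic_mat :: "nat \<Rightarrow> (real \<Rightarrow> real mat) \<Rightarrow> bool" where
  "analytic_mat n A \<longleftrightarrow> (\<forall>i<n. \<forall>j<n. real_analytic_on (\<lambda>\<mu>. A \<mu> $$ (i, j)) UNIV)"

definition taylor_coeff_mat :: "nat \<Rightarrow> (real \<Rightarrow> real mat) \<Rightarrow> nat \<Rightarrow> real mat" where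
  "taylor_coeff_mat n A l =
     mat n n (\<lambda>(i, j). (deriv ^^ l) (\<lambda>\<mu>. A \<mu> $$ (i, j)) 0 / fact l)"

definition taylor_mat :: "nat \<Rightarrow> (real \<Rightarrow> real mat) \<Rightarrow> nat \<Rightarrow> real \<Rightarrow> real mat" where
  "taylor_mat n A m \<mu> =
     mat n n (\<lambda>(i, j). \<Sum>l\<le>m. (\<mu> ^ l \<cdot>\<^sub>m taylor_coeff_mat n A l) $$ (i, j))"

text \<open>Block matrices and vectors with blocks of size \<open>n\<close>; the \<open>k\<close> block positions per
  dimension are numbered \<open>0, \<dots>, k - 1\<close>.\<close>

definition block_mat :: "nat \<Rightarrow> nat \<Rightarrow> (nat \<Rightarrow> nat \<Rightarrow> 'a mat) \<Rightarrow> 'a mat" where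
  "block_mat k n B =
     mat (k * n) (k * n) (\<lambda>(r, c). B (r div n) (c div n) $$ (r mod n, c mod n))"

definition block_vec :: "nat \<Rightarrow> nat \<Rightarrow> (nat \<Rightarrow> 'a vec) \<Rightarrow> 'a vec" where
  "block_vec k n w = vec (k * n) (\<lambda>r. w (r div n) $ (r mod n))"

definition companion_K :: "nat \<Rightarrow> (real \<Rightarrow> real mat) \<Rightarrow> nat \<Rightarrow> real mat" where
  "companion_K n A m = block_mat (m + 1) n (\<lambda>p q.
     if p = 0 then taylor_coeff_mat n A q
     else if p = q then 1\<^sub>m n
     else 0\<^sub>m n n)"

definition companion_M :: "nat \<Rightarrow> nat \<Rightarrow> real mat" where
  "companion_M n m = block_mat (m + 1) n (\<lambda>p q. if p = q + 1 then 1\<^sub>m n else 0\<^sub>m n n)"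

definition companion_c :: "nat \<Rightarrow> real vec \<Rightarrow> nat \<Rightarrow> real vec" where
  "companion_c n b m = block_vec (m + 1) n (\<lambda>p. if p = 0 then b else 0\<^sub>v n)"

definition power_stack :: "nat \<Rightarrow> nat \<Rightarrow> real \<Rightarrow> real vec \<Rightarrow> real vec" where
  "power_stack n m \<mu> x = block_vec (m + 1) n (\<lambda>p. \<mu> ^ p \<cdot>\<^sub>v x)"

end

theory Submission
  imports Defs
begin

text \<open>
  On a vector of the form \<open>[x, \<mu>x, \<dots>, \<mu>\<^sup>m x]\<close> the block rows \<open>1, \<dots>, m\<close> of
  \<open>K - \<mu>M\<close> vanish identically, while block row \<open>0\<close> evaluates to \<open>A\<^sub>m(\<mu>) x\<close>.
  Hence the companion system holds for such a vector iff its leading block equation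
  \<open>A\<^sub>m(\<mu>) x = b\<close> does.
\<close>

lemma block_index_less:
  fixes p i k n :: nat
  assumes "p < k" "i < n"
  shows "p * n + i < k * n"
proof -
  have "p * n + i < Suc p * n"
    using assms by simp
  also have "\<dots> \<le> k * n"
    using assms by (intro mult_le_mono1) simp
  finally show ?thesis .
qed

text \<open>Each flat index below \<open>k * n\<close> is \<open>q * n + j\<close> for exactly one
  block number \<open>q < k\<close> and one offset \<open>j < n\<close>. This turns the scalar
  product of a flat row into a double sum over blocks.\<close>

lemma sum_div_mod:
  fixes f :: "nat \<Rightarrow> nat \<Rightarrow> 'a::comm_monoid_add"
  shows "(\<Sum>c<k * n. f (c div n) (c mod n)) = (\<Sum>q<k. \<Sum>j<n. f q j)"
proof -
  have "(\<Sum>c<k * n. f (c div n) (c mod n))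
      = (\<Sum>q<k. \<Sum>c\<in>{q * n..<q * n + n}. f (c div n) (c mod n))"
    by (simp add: sum.nat_group)
  also have "\<dots> = (\<Sum>q<k. \<Sum>j<n. f q j)"
  proof (rule sum.cong[OF refl])
    fix q
    have "(\<Sum>c\<in>{q * n..<q * n + n}. f (c div n) (c mod n))
        = (\<Sum>j<n. f ((j + q * n) div n) ((j + q * n) mod n))"
      using sum.shift_bounds_nat_ivl[of "\<lambda>c. f (c div n) (c mod n)" 0 "q * n" n]
      by (simp add: lessThan_atLeast0 add.commute)
    also have "\<dots> = (\<Sum>j<n. f q j)"
      by (intro sum.cong) auto
    finally show "(\<Sum>c\<in>{q * n..<q * n + n}. f (c div n) (c mod n)) = (\<Sum>j<n. f q j)" .
  qed
  finally show ?thesis .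
qed

lemma block_vec_cong:
  assumes "\<And>p i. p < k \<Longrightarrow> i < n \<Longrightarrow> v p $ i = w p $ i"
  shows "block_vec k n v = block_vec k n w"
  unfolding block_vec_def
proof (rule eq_vecI)
  fix r assume "r < dim_vec (vec (k * n) (\<lambda>r. w (r div n) $ (r mod n)))"
  \<comment> \<open>The existence of an index below \<open>k * n\<close> forces \<open>n\<close> to
    be positive, which gives \<open>r mod n < n\<close>.\<close>
  then have "r < k * n" and "0 < n"
    by (auto intro: gr0I)
  then show "vec (k * n) (\<lambda>r. v (r div n) $ (r mod n)) $ r
      = vec (k * n) (\<lambda>r. w (r div n) $ (r mod n)) $ r"
    using assms[of "r div n" "r mod n"] by (simp add: less_mult_imp_div_less)
qed simp

text \<open>Entry \<open>i\<close> of block \<open>p\<close> sits at position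
  \<open>p * n + i\<close>. The block vector stores \<open>n\<close> entries of each block, so the
  carrier conditions are what turn agreement of these entries into equality of the blocks.\<close>

lemma block_vec_eqD:
  assumes "block_vec k n v = block_vec k n w" "p < k"
    and "v p \<in> carrier_vec n" "w p \<in> carrier_vec n"
  shows "v p = w p"
proof (rule eq_vecI)
  fix i assume "i < dim_vec (w p)"
  then have "i < n"
    using assms by simp
  then show "v p $ i = w p $ i"
    using arg_cong[OF assms(1), of "\<lambda>u. u $ (p * n + i)"] block_index_less[OF assms(2)]
    by (simp add: block_vec_def)
qed (use assms in simp)

text \<open>Regrouping the scalar product of a row by block columns gives the usual block product.
  Since the type of vectors does not fix a dimension, the sum over \<open>q\<close> is taken entry
  by entry and reassembled by \<open>vec n\<close>.\<close>

lemma block_mat_mult_block_vec: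
  fixes B :: "nat \<Rightarrow> nat \<Rightarrow> 'a::semiring_0 mat"
  assumes "\<And>p q. p < k \<Longrightarrow> q < k \<Longrightarrow> B p q \<in> carrier_mat n n"
    and "\<And>q. q < k \<Longrightarrow> w q \<in> carrier_vec n"
  shows "block_mat k n B *\<^sub>v block_vec k n w
    = block_vec k n (\<lambda>p. vec n (\<lambda>i. \<Sum>q<k. (B p q *\<^sub>v w q) $ i))"
proof (rule eq_vecI)
  fix r
  assume "r < dim_vec (block_vec k n (\<lambda>p. vec n (\<lambda>i. \<Sum>q<k. (B p q *\<^sub>v w q) $ i)))"
  then have r: "r < k * n" and n: "0 < n"
    by (auto simp: block_vec_def intro: gr0I)
  then have p: "r div n < k" and i: "r mod n < n"
    by (simp_all add: less_mult_imp_div_less)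
  have "(block_mat k n B *\<^sub>v block_vec k n w) $ r
      = (\<Sum>c<k * n. B (r div n) (c div n) $$ (r mod n, c mod n) * w (c div n) $ (c mod n))"
    using r by (simp add: block_mat_def block_vec_def scalar_prod_def lessThan_atLeast0)
  also have "\<dots> = (\<Sum>q<k. \<Sum>j<n. B (r div n) q $$ (r mod n, j) * w q $ j)"
    by (rule sum_div_mod)
  also have "\<dots> = (\<Sum>q<k. (B (r div n) q *\<^sub>v w q) $ (r mod n))"
  proof (rule sum.cong[OF refl])
    fix q assume "q \<in> {..<k}"
    then have "B (r div n) q \<in> carrier_mat n n" "w q \<in> carrier_vec n"
      using assms p by auto
    then show "(\<Sum>j<n. B (r div n) q $$ (r mod n, j) * w q $ j)
        = (B (r div n) q *\<^sub>v w q) $ (r mod n)"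
      using i by (auto simp: scalar_prod_def lessThan_atLeast0 intro!: sum.cong)
  qed
  finally show "(block_mat k n B *\<^sub>v block_vec k n w) $ r
      = block_vec k n (\<lambda>p. vec n (\<lambda>i. \<Sum>q<k. (B p q *\<^sub>v w q) $ i)) $ r"
    using r i by (simp add: block_vec_def)
qed (simp add: block_mat_def block_vec_def)

text \<open>A matrix difference takes its dimensions from the subtrahend, so the carrier condition
  on \<open>C\<close> is what lets the entries of each block difference be read off.\<close>

lemma block_mat_diff_smult:
  fixes B C :: "nat \<Rightarrow> nat \<Rightarrow> 'a::ring mat"
  assumes "\<And>p q. C p q \<in> carrier_mat n n"
  shows "block_mat k n B - a \<cdot>\<^sub>m block_mat k n C = block_mat k n (\<lambda>p q. B p q - a \<cdot>\<^sub>m C p q)"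
proof (rule eq_matI)
  fix r c
  assume "r < dim_row (block_mat k n (\<lambda>p q. B p q - a \<cdot>\<^sub>m C p q))"
    and "c < dim_col (block_mat k n (\<lambda>p q. B p q - a \<cdot>\<^sub>m C p q))"
  then have rc: "r < k * n" "c < k * n" and "0 < n"
    by (auto simp: block_mat_def intro: gr0I)
  then have "r mod n < n" "c mod n < n"
    by simp_all
  then show "(block_mat k n B - a \<cdot>\<^sub>m block_mat k n C) $$ (r, c)
      = block_mat k n (\<lambda>p q. B p q - a \<cdot>\<^sub>m C p q) $$ (r, c)"
    using rc assms[of "r div n" "c div n"] by (simp add: block_mat_def)
qed (simp_all add: block_mat_def)

lemma smult_mat_mult_vec:
  fixes A :: "'a::semiring_0 mat"
  assumes "A \<in> carrier_mat nr nc" "v \<in> carrier_vec nc"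
  shows "(a \<cdot>\<^sub>m A) *\<^sub>v v = a \<cdot>\<^sub>v (A *\<^sub>v v)"
  using assms by (intro eq_vecI) (auto simp: scalar_prod_def sum_distrib_left mult.assoc)

lemma taylor_coeff_mat_carrier [simp]: "taylor_coeff_mat n A l \<in> carrier_mat n n"
  by (simp add: taylor_coeff_mat_def)

lemma taylor_mat_carrier [simp]: "taylor_mat n A m \<mu> \<in> carrier_mat n n"
  by (simp add: taylor_mat_def)

text \<open>Exchanging the sum over columns with the sum over powers brings the product into the
  form in which block row 0 of the companion product appears.\<close>

lemma taylor_mat_mult_vec_index:
  assumes "x \<in> carrier_vec n" "i < n"
  shows "(taylor_mat n A m \<mu> *\<^sub>v x) $ i
    = (\<Sum>l\<le>m. \<mu> ^ l * (taylor_coeff_mat n A l *\<^sub>v x) $ i)"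
proof -
  have "(taylor_mat n A m \<mu> *\<^sub>v x) $ i
      = (\<Sum>j = 0..<n. \<Sum>l\<le>m. \<mu> ^ l * (taylor_coeff_mat n A l $$ (i, j) * x $ j))"
    using assms
    by (simp add: taylor_mat_def taylor_coeff_mat_def scalar_prod_def sum_distrib_right
        sum_distrib_left mult.assoc)
  also have "\<dots> = (\<Sum>l\<le>m. \<mu> ^ l * (\<Sum>j = 0..<n. taylor_coeff_mat n A l $$ (i, j) * x $ j))"
    by (subst sum.swap) (simp add: sum_distrib_left)
  also have "\<dots> = (\<Sum>l\<le>m. \<mu> ^ l * (taylor_coeff_mat n A l *\<^sub>v x) $ i)"
    using assms by (simp add: scalar_prod_def taylor_coeff_mat_def)
  finally show ?thesis .
qed

text \<open>Stated as an identity in \<open>x\<close>, free of \<open>b\<close>, so that both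
  directions of the equivalence follow by comparing right-hand sides.\<close>

lemma companion_mult_power_stack:
  assumes x: "x \<in> carrier_vec n"
  shows "(companion_K n A m - \<mu> \<cdot>\<^sub>m companion_M n m) *\<^sub>v power_stack n m \<mu> x
    = companion_c n (taylor_mat n A m \<mu> *\<^sub>v x) m"
proof -
  define K where "K p q = (if p = 0 then taylor_coeff_mat n A q
     else if p = q then 1\<^sub>m n else 0\<^sub>m n n)" for p q :: nat
  define M :: "nat \<Rightarrow> nat \<Rightarrow> real mat"
    where "M p q = (if p = q + 1 then 1\<^sub>m n else 0\<^sub>m n n)" for p q
  have K: "K p q \<in> carrier_mat n n" and M: "M p q \<in> carrier_mat n n" for p q
    by (simp_all add: K_def M_def)
  \<comment> \<open>In a row \<open>p > 0\<close>, the diagonal block of \<open>K\<close>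
    contributes \<open>\<mu> ^ p * x $ i\<close>, and the subdiagonal block of \<open>M\<close>
    contributes \<open>\<mu> * \<mu> ^ (p - 1) * x $ i\<close>, the same value. Two separate
    indicator terms let each sum over \<open>q\<close> collapse on its own. The truncated
    \<open>p - 1\<close> is used only for positive \<open>p\<close>.\<close>
  have entry: "((K p q - \<mu> \<cdot>\<^sub>m M p q) *\<^sub>v (\<mu> ^ q \<cdot>\<^sub>v x)) $ i
      = (if p = 0 then \<mu> ^ q * (taylor_coeff_mat n A q *\<^sub>v x) $ i
         else (if q = p then \<mu> ^ p * x $ i else 0)
            - (if q = p - 1 then \<mu> ^ p * x $ i else 0))"
    if "i < n" for p q i
  proof -
    have "(K p q - \<mu> \<cdot>\<^sub>m M p q) *\<^sub>v (\<mu> ^ q \<cdot>\<^sub>v x)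
        = \<mu> ^ q \<cdot>\<^sub>v (K p q *\<^sub>v x - \<mu> \<cdot>\<^sub>v (M p q *\<^sub>v x))"
      using x K[of p q] M[of p q]
      by (subst mult_mat_vec[of _ n n])
        (auto simp: minus_mult_distrib_mat_vec[of _ n n] smult_mat_mult_vec[of _ n n])
    moreover have "taylor_coeff_mat n A q *\<^sub>v x \<in> carrier_vec n"
      by (rule mult_mat_vec_carrier[OF taylor_coeff_mat_carrier x])
    ultimately show ?thesis
      using x that by (cases p) (auto simp: K_def M_def)
  qed
  have "(companion_K n A m - \<mu> \<cdot>\<^sub>m companion_M n m) *\<^sub>v power_stack n m \<mu> x
      = block_mat (m + 1) n (\<lambda>p q. K p q - \<mu> \<cdot>\<^sub>m M p q)
        *\<^sub>v block_vec (m + 1) n (\<lambda>q. \<mu> ^ q \<cdot>\<^sub>v x)"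
    unfolding block_mat_diff_smult[of M n "m + 1" K \<mu>, OF M, symmetric]
    by (simp add: companion_K_def companion_M_def power_stack_def K_def[abs_def] M_def[abs_def])
  also have "\<dots> = block_vec (m + 1) n (\<lambda>p. vec n (\<lambda>i.
      \<Sum>q<m + 1. ((K p q - \<mu> \<cdot>\<^sub>m M p q) *\<^sub>v (\<mu> ^ q \<cdot>\<^sub>v x)) $ i))"
    using K M x by (intro block_mat_mult_block_vec) (auto intro!: minus_carrier_mat)
  also have "\<dots> = companion_c n (taylor_mat n A m \<mu> *\<^sub>v x) m"
    unfolding companion_c_def
  proof (rule block_vec_cong)
    fix p i assume p: "p < m + 1" and i: "i < n"
    show "vec n (\<lambda>i. \<Sum>q<m + 1. ((K p q - \<mu> \<cdot>\<^sub>m M p q) *\<^sub>v (\<mu> ^ q \<cdot>\<^sub>v x)) $ i) $ i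
        = (if p = 0 then taylor_mat n A m \<mu> *\<^sub>v x else 0\<^sub>v n) $ i"
    proof (cases "p = 0")
      case True
      \<comment> \<open>Products with a vector stay folded here, so that their entries match both
        \<open>entry\<close> and the expansion of the Taylor polynomial.\<close>
      then show ?thesis
        using i by (simp add: entry taylor_mat_mult_vec_index[OF x] lessThan_Suc_atMost
            del: index_mult_mat_vec)
    next
      case False
      \<comment> \<open>Both \<open>p\<close> and \<open>p - 1\<close> must lie in the range of
        summation: then each indicator sum equals \<open>\<mu> ^ p * x $ i\<close> and the two
        cancel.\<close>
      then have "p - 1 < m + 1"
        using p by simp
      then show ?thesis
        using False i p by (simp add: entry sum_subtractf del: index_mult_mat_vec sum.lessThan_Suc)
    qed
  qed
  finally show ?thesis .
qed

theorem theorem2p1: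
  fixes A :: "real \<Rightarrow> real mat" and b :: "real vec" and n m :: nat and \<mu> :: real
  assumes A_carrier: "\<And>t. A t \<in> carrier_mat n n"
    and A_nonsingular: "\<And>t. invertible_mat (A t)"
    and A_analytic: "analytic_mat n A"
    and m_ge: "m \<ge> 1"
    and A_m_nonsingular: "invertible_mat (taylor_mat n A m \<mu>)"
    and b_carrier: "b \<in> carrier_vec n"
  shows "(\<forall>v \<in> carrier_vec ((m + 1) * n). \<forall>x \<in> carrier_vec n.
            (companion_K n A m - \<mu> \<cdot>\<^sub>m companion_M n m) *\<^sub>v v = companion_c n b m \<longrightarrow>
            v = power_stack n m \<mu> x \<longrightarrow>
            taylor_mat n A m \<mu> *\<^sub>v x = b)
       \<and> (\<forall>x \<in> carrier_vec n.
            taylor_mat n A m \<mu> *\<^sub>v x = b \<longrightarrow>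
            (companion_K n A m - \<mu> \<cdot>\<^sub>m companion_M n m) *\<^sub>v power_stack n m \<mu> x
              = companion_c n b m)"
proof (intro conjI ballI impI)
  fix v x
  assume x: "x \<in> carrier_vec n"
    and "(companion_K n A m - \<mu> \<cdot>\<^sub>m companion_M n m) *\<^sub>v v = companion_c n b m"
    and "v = power_stack n m \<mu> x"
  then have "companion_c n (taylor_mat n A m \<mu> *\<^sub>v x) m = companion_c n b m"
    by (simp add: companion_mult_power_stack)
  \<comment> \<open>Both sides are vectors of dimension \<open>n\<close>, so comparing the leading
    blocks recovers the equation.\<close>
  then show "taylor_mat n A m \<mu> *\<^sub>v x = b"
    using b_carrier mult_mat_vec_carrier[OF taylor_mat_carrier x]
    unfolding companion_c_def by (auto dest: block_vec_eqD[where p = 0])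
next
  fix x
  assume "x \<in> carrier_vec n" and "taylor_mat n A m \<mu> *\<^sub>v x = b"
  then show "(companion_K n A m - \<mu> \<cdot>\<^sub>m companion_M n m) *\<^sub>v power_stack n m \<mu> x
      = companion_c n b m"
    by (simp add: companion_mult_power_stack)
qed

end
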